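(* Assume that a class of languages $\mathcal{C}$ satisfies the following closure property: if $L\subseteq\Sigma^*$ is in the class $\mathcal{C}$ and $L_0$ is a finite language over some finite alphabet $\Sigma_0$ for which $\Sigma\cap\Sigma_0=\varnothing$, then the concatenation $LL_0$ is in the class $\mathcal{C}$. Then a finite extension of a $\mathcal{C}$-Cayley p.f. linear-time computable group is $\mathcal{C}$-Cayley p.f. linear-time computable; that is, if $H$ is a subgroup of finite index of a group $G$ and $H$ is $\mathcal{C}$-Cayley p.f. linear-time computable, then so is $G$.
   Context: Position-faithful one-tape Turing machine: a Turing machine with one semi-infinite tape (infinite in one direction only) whose left-most cell contains a special symbol $\boxplus$ which occurs only there and cannot be modified. On input $x\in\Sigma^*$ the initial tape content is $\boxplus x\boxdot^\infty$, where $\boxdot$ is a special blank symbol and $\Sigma\cap\{\boxplus,\boxdot\}=\varnothing$, and the head starts at $\boxplus$. The machine computes $f:\Sigma^*\to\Sigma^*$ if on every input $x\in\Sigma^*$ it eventually reaches an accepting state and halts with the tape having prefix $\boxplus f(x)\boxdot$ (no restriction on the tape content after this first $\boxdot$). A function $f:\Sigma^*\to\Sigma^*$ is position-faithful (p.f.) linear-time computable if it is computed by a deterministic position-faithful one-tape Turing machine in time linear in the input length. Let $G$ be a finitely generated group, $S=\{s_1,\dots,s_n\}\subset G$ a finite set of semigroup generators (every $g\in G$ is a product of elements of $S$), and $\mathcal{C}$ a nonempty class of languages. $G$ is $\mathcal{C}$-Cayley p.f. linear-time computable if there exist a language $L\subseteq\Sigma^*$ in the class $\mathcal{C}$ over a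 finite alphabet $\Sigma$, a bijection $\psi:L\to G$ and p.f. linear-time computable functions $f_i:\Sigma^*\to\Sigma^*$, $i=1,\dots,n$, with $f_i(L)\subseteq L$ and $\psi(f_i(w))=\psi(w)s_i$ for all $w\in L$. This notion does not depend on the choice of $S$. Standing assumption: $\mathcal{C}$ is closed under a change of symbols in the alphabet: if $\xi:\Sigma\to\Sigma'$ is a bijection between finite alphabets and $L\subseteq\Sigma^*$ is in $\mathcal{C}$, then the image of $L$ under the homomorphism induced by $\xi$ is in $\mathcal{C}$. *)

theory Defs
  imports "HOL-Algebra.Coset" "HOL-Library.Infinite_Typeclass"
begin

text \<open>
  Tape symbols over input symbols of type \<open>'a\<close>. \<open>Marker\<close> is the special symbol of the left-most
  cell; both it and \<open>Blank\<close> are distinct from every input symbol by construction. The symbols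
  \<open>Work i\<close> are auxiliary tape symbols, so a machine is never short of them, whatever \<open>'a\<close> is.
\<close>

datatype 'a cell = Marker | Blank | Letter 'a | Work nat

datatype move = MLeft | MStay | MRight

record 'a tm =
  states :: "nat set"
  tape_alphabet :: "'a cell set"
  start :: nat
  accepting :: "nat set"
  delta :: "nat \<Rightarrow> 'a cell \<Rightarrow> nat \<times> 'a cell \<times> move"

text \<open>
  The last two conditions say that the marker cannot be modified or created elsewhere, and that the
  head does not leave the tape to the left.
\<close>

definition pf_tm :: "'a set \<Rightarrow> 'a tm \<Rightarrow> bool" where
  "pf_tm \<Sigma> M \<longleftrightarrow>
     finite (states M) \<and> finite (tape_alphabet M) \<and>
     {Marker, Blank} \<union> Letter ` \<Sigma> \<subseteq> tape_alphabet M \<and>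
     start M \<in> states M \<and> accepting M \<subseteq> states M \<and>
     (\<forall>q\<in>states M. \<forall>a\<in>tape_alphabet M. \<forall>q' b d. delta M q a = (q', b, d) \<longrightarrow>
        q' \<in> states M \<and> b \<in> tape_alphabet M \<and>
        (b = Marker \<longleftrightarrow> a = Marker) \<and>
        (a = Marker \<longrightarrow> d \<noteq> MLeft))"

text \<open>A configuration consists of the state, the head position and the tape content.\<close>

type_synonym 'a config = "nat \<times> nat \<times> (nat \<Rightarrow> 'a cell)"

fun move_head :: "move \<Rightarrow> nat \<Rightarrow> nat" where
  "move_head MLeft p = p - 1"
| "move_head MStay p = p"
| "move_head MRight p = Suc p"

text \<open>The machine halts upon reaching an accepting state: such configurations are fixed points.\<close>

definition tm_step :: "'a tm \<Rightarrow> 'a config \<Rightarrow> 'a config" where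
  "tm_step M = (\<lambda>(q, p, t).
     if q \<in> accepting M then (q, p, t)
     else (let (q', b, d) = delta M q (t p) in (q', move_head d p, t(p := b))))"

definition initial_tape :: "'a list \<Rightarrow> nat \<Rightarrow> 'a cell" where
  "initial_tape x i =
     (if i = 0 then Marker else if i \<le> length x then Letter (x ! (i - 1)) else Blank)"

definition initial_config :: "'a tm \<Rightarrow> 'a list \<Rightarrow> 'a config" where
  "initial_config M x = (start M, 0, initial_tape x)"

text \<open>Nothing is required of the tape after the first blank following the output.\<close>

definition has_output :: "(nat \<Rightarrow> 'a cell) \<Rightarrow> 'a list \<Rightarrow> bool" where
  "has_output t y \<longleftrightarrow>
     t 0 = Marker \<and> (\<forall>i<length y. t (Suc i) = Letter (y ! i)) \<and> t (Suc (length y)) = Blank"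

definition accepts_within :: "'a tm \<Rightarrow> nat \<Rightarrow> 'a list \<Rightarrow> 'a list \<Rightarrow> bool" where
  "accepts_within M T x y \<longleftrightarrow>
     (\<exists>n\<le>T. \<exists>q p t. (tm_step M ^^ n) (initial_config M x) = (q, p, t) \<and>
        q \<in> accepting M \<and> has_output t y)"

text \<open>
  Linear time is time at most \<open>c * (|x| + 1)\<close>; the summand \<open>1\<close> only matters for the empty input.
  Only the values of \<open>f\<close> on \<open>lists \<Sigma>\<close> are relevant.
\<close>

definition pf_linear_time_computable :: "'a set \<Rightarrow> ('a list \<Rightarrow> 'a list) \<Rightarrow> bool" where
  "pf_linear_time_computable \<Sigma> f \<longleftrightarrow>
     f ` lists \<Sigma> \<subseteq> lists \<Sigma> \<and>
     (\<exists>M c. pf_tm \<Sigma> M \<and> (\<forall>x\<in>lists \<Sigma>. accepts_within M (c * (length x + 1)) x (f x)))"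

text \<open>
  A class of languages is a set of pairs \<open>(\<Sigma>, L)\<close>, where \<open>(\<Sigma>, L)\<close> stands for
  \<open>L\<close> regarded as a language over the finite alphabet \<open>\<Sigma>\<close>. A class \<open>D\<close> of languages without
  designated alphabets is represented by all such pairs with \<open>L \<in> D\<close>.
\<close>

type_synonym 'a lang_class = "('a set \<times> 'a list set) set"

definition language_class :: "'a lang_class \<Rightarrow> bool" where
  "language_class C \<longleftrightarrow> C \<noteq> {} \<and> (\<forall>(\<Sigma>, L)\<in>C. finite \<Sigma> \<and> L \<subseteq> lists \<Sigma>)"

definition closed_under_symbol_change :: "'a lang_class \<Rightarrow> bool" where
  "closed_under_symbol_change C \<longleftrightarrow>
     (\<forall>\<Sigma> L \<Sigma>' \<xi>. (\<Sigma>, L) \<in> C \<and> finite \<Sigma>' \<and> bij_betw \<xi> \<Sigma> \<Sigma>' \<longrightarrow> (\<Sigma>', map \<xi> ` L) \<in> C)"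

definition closed_under_disjoint_finite_concat :: "'a lang_class \<Rightarrow> bool" where
  "closed_under_disjoint_finite_concat C \<longleftrightarrow>
     (\<forall>\<Sigma> L \<Sigma>\<^sub>0 L\<^sub>0. (\<Sigma>, L) \<in> C \<and> finite \<Sigma>\<^sub>0 \<and> finite L\<^sub>0 \<and> L\<^sub>0 \<subseteq> lists \<Sigma>\<^sub>0 \<and> \<Sigma> \<inter> \<Sigma>\<^sub>0 = {} \<longrightarrow>
        (\<Sigma> \<union> \<Sigma>\<^sub>0, {u @ v | u v. u \<in> L \<and> v \<in> L\<^sub>0}) \<in> C)"

inductive_set semigroup_span :: "('g, 'm) monoid_scheme \<Rightarrow> 'g set \<Rightarrow> 'g set"
  for G (structure) and S where
  incl: "s \<in> S \<Longrightarrow> s \<in> semigroup_span G S"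
| mult: "g \<in> semigroup_span G S \<Longrightarrow> s \<in> S \<Longrightarrow> g \<otimes> s \<in> semigroup_span G S"

definition finite_semigroup_generators :: "('g, 'm) monoid_scheme \<Rightarrow> 'g set \<Rightarrow> bool" where
  "finite_semigroup_generators G S \<longleftrightarrow>
     finite S \<and> S \<subseteq> carrier G \<and> carrier G \<subseteq> semigroup_span G S"

definition cayley_pf_linear_time_wrt ::
  "'a lang_class \<Rightarrow> ('g, 'm) monoid_scheme \<Rightarrow> 'g set \<Rightarrow> bool" where
  "cayley_pf_linear_time_wrt C G S \<longleftrightarrow>
     (\<exists>\<Sigma> L \<psi> f. (\<Sigma>, L) \<in> C \<and> bij_betw \<psi> L (carrier G) \<and>
        (\<forall>s\<in>S. pf_linear_time_computable \<Sigma> (f s) \<and>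
           (\<forall>w\<in>L. f s w \<in> L \<and> \<psi> (f s w) = \<psi> w \<otimes>\<^bsub>G\<^esub> s)))"

text \<open>The choice of the finite generating set is immaterial; finite generation is included.\<close>

definition cayley_pf_linear_time :: "'a lang_class \<Rightarrow> ('g, 'm) monoid_scheme \<Rightarrow> bool" where
  "cayley_pf_linear_time C G \<longleftrightarrow>
     (\<exists>S. finite_semigroup_generators G S \<and> cayley_pf_linear_time_wrt C G S)"

end

theory Submission
  imports Defs
begin

text \<open>
  Choose representatives \<open>a\<^sub>1, \<dots>, a\<^sub>m\<close> of the right cosets of \<open>H\<close> in \<open>G\<close> and fresh letters
  \<open>b\<^sub>1, \<dots>, b\<^sub>m\<close>. Every element of \<open>G\<close> is \<open>h \<otimes> a\<^sub>j\<close> for exactly one pair \<open>(h, j)\<close>, so if \<open>\<psi>\<close> is a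
  bijection from \<open>L\<close> to \<open>H\<close>, then \<open>w b\<^sub>j \<mapsto> \<psi> w \<otimes> a\<^sub>j\<close> is a bijection from \<open>L {b\<^sub>1, \<dots>, b\<^sub>m}\<close>, which
  is again a language of the class, to \<open>G\<close>. The generators of \<open>H\<close> and the \<open>a\<^sub>j\<close> together generate
  \<open>G\<close> as a semigroup. For \<open>s\<close> in \<open>G\<close> write \<open>a\<^sub>j \<otimes> s = h\<^sub>j \<otimes> a\<^sub>k\<close>, where \<open>k\<close> depends on \<open>j\<close>;
  multiplying \<open>w b\<^sub>j\<close> by \<open>s\<close> means replacing \<open>w\<close> by the word for \<open>\<psi> w \<otimes> h\<^sub>j\<close> and \<open>b\<^sub>j\<close> by \<open>b\<^sub>k\<close>.
  There are only finitely many \<open>h\<^sub>j\<close>, each a product of generators of \<open>H\<close>, so right multiplication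
  by \<open>h\<^sub>j\<close> is computed on \<open>L\<close> by composing the given functions.

  What remains is that a one-tape machine can do this in linear time, and the difficulty is the
  residue which a computation may leave beyond the first blank: it would be read as input
  by a machine started afterwards. Lemma \<open>tidily_computable_if_pf_linear_time\<close> removes it. The
  machine is simulated with a second blank, used wherever the machine writes a blank; a genuine
  blank then occurs only in cells never visited, so the residue ends at the first genuine blank and
  can be erased in time proportional to the time already spent. Machines that leave the tape tidy
  can be run one after the other (\<open>tidily_computable_compose\<close>), and can be applied to what precedes
  the last letter (\<open>pf_linear_time_computable_last_letter\<close>): remember \<open>b\<^sub>j\<close> in the state, erase it,
  run the machine for \<open>h\<^sub>j\<close> and append \<open>b\<^sub>k\<close>.
\<close>

section \<open>Machines with arbitrary state types\<close>

definition step_by ::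
  "('s \<Rightarrow> 'a cell \<Rightarrow> 's \<times> 'a cell \<times> move) \<Rightarrow>
   's \<times> nat \<times> (nat \<Rightarrow> 'a cell) \<Rightarrow> 's \<times> nat \<times> (nat \<Rightarrow> 'a cell)" where
  "step_by \<delta> = (\<lambda>(q, p, t). let (q', b, d) = \<delta> q (t p) in (q', move_head d p, t(p := b)))"

text \<open>
  The analogue of \<open>pf_tm\<close> for an arbitrary type of states, so that the phases of a machine can be
  constructors of a datatype. There is one halting state \<open>h\<close>, which must loop: runs then need no case
  distinction for having halted, since an accepting configuration of a \<open>tm\<close> is a fixed point as well.
\<close>

definition pf_machine ::
  "'a set \<Rightarrow> 's set \<Rightarrow> 'a cell set \<Rightarrow> 's \<Rightarrow> 's \<Rightarrow> ('s \<Rightarrow> 'a cell \<Rightarrow> 's \<times> 'a cell \<times> move) \<Rightarrow> bool" where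
  "pf_machine \<Sigma> Q \<Gamma> q\<^sub>0 h \<delta> \<longleftrightarrow>
     finite Q \<and> finite \<Gamma> \<and> {Marker, Blank} \<union> Letter ` \<Sigma> \<subseteq> \<Gamma> \<and> q\<^sub>0 \<in> Q \<and> h \<in> Q \<and>
     (\<forall>a. \<delta> h a = (h, a, MStay)) \<and>
     (\<forall>q\<in>Q. \<forall>a\<in>\<Gamma>. \<forall>q' b d. \<delta> q a = (q', b, d) \<longrightarrow>
        q' \<in> Q \<and> b \<in> \<Gamma> \<and> (b = Marker \<longleftrightarrow> a = Marker) \<and> (a = Marker \<longrightarrow> d \<noteq> MLeft))"

text \<open>
  Single steps are written as runs of length one, so that \<open>run_trans\<close> chains them with longer runs.
\<close>

lemma step_byI:
  assumes "\<delta> q (t p) = (q', b, d)" "p' = move_head d p" "t' = t(p := b)"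
  shows "(step_by \<delta> ^^ 1) (q, p, t) = (q', p', t')"
  using assms by (simp add: step_by_def)

lemma run_trans:
  assumes "(F ^^ m) x = y" "(F ^^ n) y = z"
  shows "(F ^^ (m + n)) x = z"
  using assms by (metis add.commute comp_apply funpow_add)

lemma run_Suc: "(F ^^ Suc n) x = (F ^^ n) (F x)"
  by (metis comp_apply funpow_Suc_right)

lemma sweep_right:
  assumes "\<And>i. p \<le> i \<Longrightarrow> i < p' \<Longrightarrow> \<delta> q (t i) = (q, w i, MRight)" and "p \<le> p'"
  shows "(step_by \<delta> ^^ (p' - p)) (q, p, t) = (q, p', \<lambda>i. if p \<le> i \<and> i < p' then w i else t i)"
  using assms(2,1)
proof (induction p' rule: dec_induct)
  case base
  have "(\<lambda>i. if p \<le> i \<and> i < p then w i else t i) = t"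
    by (auto simp: fun_eq_iff)
  then show ?case by simp
next
  case (step n)
  have "(step_by \<delta> ^^ (n - p)) (q, p, t) = (q, n, \<lambda>i. if p \<le> i \<and> i < n then w i else t i)"
    using step by auto
  moreover have "(step_by \<delta> ^^ 1) (q, n, \<lambda>i. if p \<le> i \<and> i < n then w i else t i)
      = (q, Suc n, \<lambda>i. if p \<le> i \<and> i < Suc n then w i else t i)"
    by (rule step_byI[where d = MRight and b = "w n"]) (use step in \<open>auto simp: fun_eq_iff\<close>)
  ultimately have "(step_by \<delta> ^^ (n - p + 1)) (q, p, t)
      = (q, Suc n, \<lambda>i. if p \<le> i \<and> i < Suc n then w i else t i)"
    by (rule run_trans)
  then show ?case using step by (simp add: Suc_diff_le)
qed

lemma scan_right:
  assumes "\<And>i. p \<le> i \<Longrightarrow> i < p' \<Longrightarrow> \<delta> q (t i) = (q, t i, MRight)" and "p \<le> p'"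
  shows "(step_by \<delta> ^^ (p' - p)) (q, p, t) = (q, p', t)"
  using sweep_right[of p p' \<delta> q t t] assms by simp

lemma rewind:
  assumes "\<And>i. 0 < i \<Longrightarrow> i \<le> p \<Longrightarrow> \<delta> q (t i) = (q, t i, MLeft)"
  shows "(step_by \<delta> ^^ p) (q, p, t) = (q, 0, t)"
  using assms
proof (induction p)
  case (Suc p)
  then have "step_by \<delta> (q, Suc p, t) = (q, p, t)"
    by (simp add: step_by_def)
  then show ?case using Suc by (simp only: run_Suc)
qed simp

lemma pf_tm_basics:
  assumes "pf_tm \<Sigma> M"
  shows "finite (states M)" "finite (tape_alphabet M)" "Marker \<in> tape_alphabet M"
    "Blank \<in> tape_alphabet M" "Letter ` \<Sigma> \<subseteq> tape_alphabet M" "start M \<in> states M"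
  using assms unfolding pf_tm_def by blast+

lemma pf_tm_delta:
  assumes "pf_tm \<Sigma> M" "q \<in> states M" "a \<in> tape_alphabet M" "delta M q a = (q', b, d)"
  shows "q' \<in> states M \<and> b \<in> tape_alphabet M \<and> (b = Marker \<longleftrightarrow> a = Marker) \<and>
     (a = Marker \<longrightarrow> d \<noteq> MLeft)"
proof -
  have "\<forall>q\<in>states M. \<forall>a\<in>tape_alphabet M. \<forall>q' b d. delta M q a = (q', b, d) \<longrightarrow>
      q' \<in> states M \<and> b \<in> tape_alphabet M \<and> (b = Marker \<longleftrightarrow> a = Marker) \<and> (a = Marker \<longrightarrow> d \<noteq> MLeft)"
    using assms(1) unfolding pf_tm_def by (elim conjE)
  from this[rule_format, OF assms(2-4)] show ?thesis by simp
qed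

lemma pf_tm_step_closed:
  assumes "pf_tm \<Sigma> M" "q \<in> states M" "range t \<subseteq> tape_alphabet M" "delta M q (t p) = (q', b, d)"
  shows "q' \<in> states M \<and> range (t(p := b)) \<subseteq> tape_alphabet M"
proof -
  have "t p \<in> tape_alphabet M" using assms by auto
  then have "q' \<in> states M \<and> b \<in> tape_alphabet M"
    using pf_tm_delta[OF assms(1,2) _ assms(4)] by simp
  then show ?thesis using assms(3) by (auto simp: fun_upd_def)
qed

text \<open>
  A machine used as a subroutine. The length of the run may shrink because the \<open>n\<close> steps of the
  machine can include idle steps in an accepting state, where the calling machine already goes on.
\<close>

lemma tm_run_embeds:
  assumes M: "pf_tm \<Sigma> M"
    and emb: "\<And>q a q' b d. q \<in> states M \<Longrightarrow> q \<notin> accepting M \<Longrightarrow> a \<in> tape_alphabet M \<Longrightarrow>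
               delta M q a = (q', b, d) \<Longrightarrow> \<delta> (e q) a = (e q', b, d)"
    and "(tm_step M ^^ n) (q, p, t) = (q', p', t')"
    and "q \<in> states M" "range t \<subseteq> tape_alphabet M"
  shows "\<exists>m\<le>n. (step_by \<delta> ^^ m) (e q, p, t) = (e q', p', t')"
  using assms(3-)
proof (induction n arbitrary: q p t)
  case 0
  then show ?case by simp
next
  case (Suc n)
  show ?case
  proof (cases "q \<in> accepting M")
    case True
    then have "tm_step M (q, p, t) = (q, p, t)"
      by (simp add: tm_step_def)
    then have "(tm_step M ^^ Suc n) (q, p, t) = (q, p, t)"
      by (induction n) auto
    then have "(step_by \<delta> ^^ 0) (e q, p, t) = (e q', p', t')"
      using Suc.prems(1) by simp
    then show ?thesis by blast
  next
    case False
    obtain q1 b d where d: "delta M q (t p) = (q1, b, d)" by (metis prod_cases3)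
    then have 1: "tm_step M (q, p, t) = (q1, move_head d p, t(p := b))"
      using False by (simp add: tm_step_def)
    have "t p \<in> tape_alphabet M" using Suc.prems by auto
    then have 2: "step_by \<delta> (e q, p, t) = (e q1, move_head d p, t(p := b))"
      using emb[OF Suc.prems(2) False _ d] by (simp add: step_by_def)
    have 3: "(tm_step M ^^ n) (q1, move_head d p, t(p := b)) = (q', p', t')"
      using Suc.prems(1) 1 by (simp only: run_Suc)
    have "q1 \<in> states M" "range (t(p := b)) \<subseteq> tape_alphabet M"
      using pf_tm_step_closed[OF M Suc.prems(2,3) d] by (rule conjunct1, rule conjunct2)
    from Suc.IH[OF 3 this] obtain m where m: "m \<le> n"
      "(step_by \<delta> ^^ m) (e q1, move_head d p, t(p := b)) = (e q', p', t')"
      by (elim exE conjE)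
    have "(step_by \<delta> ^^ Suc m) (e q, p, t) = (e q', p', t')"
      using 2 m(2) by (simp only: run_Suc)
    moreover have "Suc m \<le> Suc n" using m(1) by simp
    ultimately show ?thesis by (intro exI conjI)
  qed
qed

text \<open>
  Only finitely many states matter, so they can be numbered; the run is reproduced step by step.
\<close>

lemma pf_machine_to_tm:
  fixes Q :: "'s set"
  assumes P: "pf_machine \<Sigma> Q \<Gamma> q\<^sub>0 h \<delta>"
  obtains M where "pf_tm \<Sigma> M"
    "\<And>n p t p' t'. range t \<subseteq> \<Gamma> \<Longrightarrow> (step_by \<delta> ^^ n) (q\<^sub>0, p, t) = (h, p', t') \<Longrightarrow>
       \<exists>q\<in>accepting M. (tm_step M ^^ n) (start M, p, t) = (q, p', t')"
proof -
  have "finite Q" using P by (simp add: pf_machine_def)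
  then obtain enc :: "'s \<Rightarrow> nat" where enc: "inj_on enc Q"
    using finite_imp_inj_to_nat_seg by blast
  define M where "M = \<lparr>states = enc ` Q, tape_alphabet = \<Gamma>, start = enc q\<^sub>0, accepting = {enc h},
     delta = \<lambda>n a. let (q', b, d) = \<delta> (inv_into Q enc n) a in (enc q', b, d)\<rparr>"
  have closed: "q' \<in> Q \<and> b \<in> \<Gamma> \<and> (b = Marker \<longleftrightarrow> a = Marker) \<and> (a = Marker \<longrightarrow> d \<noteq> MLeft)"
    if "q \<in> Q" "a \<in> \<Gamma>" "\<delta> q a = (q', b, d)" for q a q' b d
  proof -
    have "\<forall>q\<in>Q. \<forall>a\<in>\<Gamma>. \<forall>q' b d. \<delta> q a = (q', b, d) \<longrightarrow>
        q' \<in> Q \<and> b \<in> \<Gamma> \<and> (b = Marker \<longleftrightarrow> a = Marker) \<and> (a = Marker \<longrightarrow> d \<noteq> MLeft)"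
      using P unfolding pf_machine_def by (elim conjE)
    from this[rule_format, OF that] show ?thesis by simp
  qed
  have delta: "delta M (enc q) a = (enc q', b, d)" if "q \<in> Q" "\<delta> q a = (q', b, d)" for q a q' b d
    using that enc by (simp add: M_def)
  have "pf_tm \<Sigma> M"
    unfolding pf_tm_def
  proof (intro conjI ballI allI impI; (elim conjE)?)
    fix s a s' b d assume s: "s \<in> states M" and a: "a \<in> tape_alphabet M" and d: "delta M s a = (s', b, d)"
    obtain q where q: "q \<in> Q" "s = enc q" using s by (auto simp: M_def)
    obtain q' b' d' where d': "\<delta> q a = (q', b', d')" by (metis prod_cases3)
    have a': "a \<in> \<Gamma>" using a by (simp add: M_def)
    have eq: "s' = enc q'" "b = b'" "d = d'"
      using delta[OF q(1) d'] d q by auto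
    note closed[OF q(1) a' d']
    then show "s' \<in> states M" "b \<in> tape_alphabet M" "(b = Marker) = (a = Marker)"
      "a = Marker \<Longrightarrow> d \<noteq> MLeft"
      using eq by (auto simp: M_def)
  qed (use P in \<open>auto simp: M_def pf_machine_def\<close>)
  moreover have sim: "(tm_step M ^^ n) (enc q, p, t) = (enc h, p', t')"
    if "q \<in> Q" "range t \<subseteq> \<Gamma>" "(step_by \<delta> ^^ n) (q, p, t) = (h, p', t')" for n q p t p' t'
    using that
  proof (induction n arbitrary: q p t)
    case 0
    then show ?case by simp
  next
    case (Suc n)
    obtain q1 b d where d: "\<delta> q (t p) = (q1, b, d)" by (metis prod_cases3)
    have tp: "t p \<in> \<Gamma>" using Suc.prems by auto
    have 1: "step_by \<delta> (q, p, t) = (q1, move_head d p, t(p := b))"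
      using d by (simp add: step_by_def)
    have c: "q1 \<in> Q" "range (t(p := b)) \<subseteq> \<Gamma>"
      using closed[OF Suc.prems(1) tp d] Suc.prems(2) by auto
    have "tm_step M (enc q, p, t) = (enc q1, move_head d p, t(p := b))"
    proof (cases "q = h")
      case True
      then have "\<delta> q (t p) = (q, t p, MStay)" using P by (simp add: pf_machine_def)
      then have "q1 = q" "t(p := b) = t" "d = MStay" using d by auto
      then show ?thesis using True by (simp add: tm_step_def M_def)
    next
      case False
      have "h \<in> Q" using P by (simp add: pf_machine_def)
      then have "enc q \<noteq> enc h" using False Suc.prems(1) enc by (auto dest: inj_onD)
      then have "enc q \<notin> accepting M" by (simp add: M_def)
      then show ?thesis using delta[OF Suc.prems(1) d] by (simp add: tm_step_def)
    qed
    moreover have "(tm_step M ^^ n) (enc q1, move_head d p, t(p := b)) = (enc h, p', t')"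
      using Suc.IH[OF c] Suc.prems(3) 1 by (simp only: run_Suc)
    ultimately show ?case by (simp only: run_Suc)
  qed
  moreover have "q\<^sub>0 \<in> Q" using P by (simp add: pf_machine_def)
  ultimately show ?thesis
    by (intro that[of M]) (auto simp: M_def)
qed

lemma range_initial_tape:
  assumes "x \<in> lists \<Sigma>" "{Marker, Blank} \<union> Letter ` \<Sigma> \<subseteq> \<Gamma>"
  shows "range (initial_tape x) \<subseteq> \<Gamma>"
proof -
  have "initial_tape x i \<in> \<Gamma>" for i
    using assms nth_mem[of "i - 1" x] by (auto simp: initial_tape_def in_lists_conv_set image_subset_iff)
  then show ?thesis by auto
qed

section \<open>Tidy computations\<close>

text \<open>
  Here the final tape is exactly the initial tape for the result, and the head is back on the marker,
  so that another machine can start right there. The bare notion of computability permits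
  arbitrary tape content beyond the first blank.
\<close>

definition tidily_computable :: "'a set \<Rightarrow> ('a list \<Rightarrow> 'a list) \<Rightarrow> bool" where
  "tidily_computable \<Sigma> f \<longleftrightarrow>
     f ` lists \<Sigma> \<subseteq> lists \<Sigma> \<and>
     (\<exists>M c. pf_tm \<Sigma> M \<and> (\<forall>x\<in>lists \<Sigma>. \<exists>n\<le>c * (length x + 1). \<exists>q\<in>accepting M.
        (tm_step M ^^ n) (start M, 0, initial_tape x) = (q, 0, initial_tape (f x))))"

text \<open>
  The simulated machine may halt anywhere, even inside the residue, so the end of the output has to
  be sought from the marker (\<open>Back\<close>, \<open>Forward\<close>) before the erasing (\<open>Clear\<close>) can begin.
\<close>

datatype tidy_state = Simulate nat | Back | Forward | Clear | Home | Done

definition unmask :: "nat \<Rightarrow> 'a cell \<Rightarrow> 'a cell" where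
  "unmask k a = (if a = Work k then Blank else a)"

definition mask :: "nat \<Rightarrow> 'a cell \<Rightarrow> 'a cell" where
  "mask k a = (if a = Blank then Work k else a)"

fun tidy_delta :: "'a tm \<Rightarrow> nat \<Rightarrow> tidy_state \<Rightarrow> 'a cell \<Rightarrow> tidy_state \<times> 'a cell \<times> move" where
  "tidy_delta M k (Simulate q) a =
     (if q \<in> accepting M then (Back, a, MStay)
      else let (q', b, d) = delta M q (unmask k a) in (Simulate q', mask k b, d))"
| "tidy_delta M k Back a = (if a = Marker then (Forward, a, MRight) else (Back, a, MLeft))"
| "tidy_delta M k Forward a =
     (case a of Letter x \<Rightarrow> (Forward, a, MRight) | _ \<Rightarrow> (Clear, a, MStay))"
| "tidy_delta M k Clear a =
     (if a = Marker then (Done, a, MStay)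
      else if a = Blank then (Home, a, MStay) else (Clear, Blank, MRight))"
| "tidy_delta M k Home a = (if a = Marker then (Done, a, MStay) else (Home, a, MLeft))"
| "tidy_delta M k Done a = (Done, a, MStay)"

text \<open>
  The tape \<open>s\<close> of the simulating machine represents the tape \<open>t\<close> of \<open>M\<close>. The condition on \<open>Blank\<close>
  says that genuine blanks begin at \<open>N\<close>, which is what lets the clean-up find the end of the residue;
  the condition on \<open>Marker\<close> lets it find the left end of the tape.
\<close>

definition masks ::
  "'a tm \<Rightarrow> nat \<Rightarrow> nat \<Rightarrow> nat \<Rightarrow> (nat \<Rightarrow> 'a cell) \<Rightarrow> (nat \<Rightarrow> 'a cell) \<Rightarrow> nat \<Rightarrow> bool" where
  "masks M k q p t s N \<longleftrightarrow>
     q \<in> states M \<and> range s \<subseteq> insert (Work k) (tape_alphabet M) \<and> (\<forall>i. unmask k (s i) = t i) \<and>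
     (\<forall>i. s i = Blank \<longleftrightarrow> N \<le> i) \<and> (\<forall>i. s i = Marker \<longleftrightarrow> i = 0) \<and> p \<le> N"

lemma unmask_in_alphabet:
  assumes "pf_tm \<Sigma> M" "a \<in> insert (Work k) (tape_alphabet M)"
  shows "unmask k a \<in> tape_alphabet M"
  using assms(2) pf_tm_basics[OF assms(1)] by (auto simp: unmask_def)

text \<open>
  The written cell never becomes a genuine blank, and as \<open>p \<le> N\<close> the region of other cells stays an
  initial segment, growing by at most one cell.
\<close>

lemma masks_step:
  assumes M: "pf_tm \<Sigma> M" and k: "Work k \<notin> tape_alphabet M"
    and r: "masks M k q p t s N" and d: "delta M q (t p) = (q', b, d)"
  shows "masks M k q' (move_head d p) (t(p := b)) (s(p := mask k b)) (max N (Suc p))"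
proof -
  have u: "unmask k (s p) = t p" using r by (simp add: masks_def)
  have "s p \<in> insert (Work k) (tape_alphabet M)" using r unfolding masks_def by blast
  then have tp: "t p \<in> tape_alphabet M" using unmask_in_alphabet[OF M] u by metis
  have q: "q \<in> states M" using r by (simp add: masks_def)
  have c: "q' \<in> states M" "b \<in> tape_alphabet M" "b = Marker \<longleftrightarrow> t p = Marker"
    using pf_tm_delta[OF M q tp d] by simp_all
  have "t p = Marker \<longleftrightarrow> s p = Marker"
    using u by (auto simp: unmask_def split: if_splits)
  then have bm: "b = Marker \<longleftrightarrow> p = 0" using c r by (simp add: masks_def)
  have "b \<noteq> Work k" using c k by auto
  then have m: "unmask k (mask k b) = b" "mask k b \<noteq> Blank" "mask k b = Marker \<longleftrightarrow> p = 0"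
    "mask k b \<in> insert (Work k) (tape_alphabet M)"
    using c bm by (auto simp: mask_def unmask_def)
  have p: "p \<le> N" using r by (simp add: masks_def)
  show ?thesis
    unfolding masks_def
  proof (intro conjI allI)
    show "range (s(p := mask k b)) \<subseteq> insert (Work k) (tape_alphabet M)"
      using r m(4) unfolding masks_def by (auto simp del: insert_iff)
    show "unmask k ((s(p := mask k b)) i) = (t(p := b)) i" for i
      using r m(1) by (simp add: masks_def)
    show "(s(p := mask k b)) i = Blank \<longleftrightarrow> max N (Suc p) \<le> i" for i
      using r m(2) p unfolding masks_def by (cases "i = p") (auto simp: max_def)
    show "(s(p := mask k b)) i = Marker \<longleftrightarrow> i = 0" for i
      using r m(3) by (simp add: masks_def)
    show "move_head d p \<le> max N (Suc p)"
      by (cases d) auto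
  qed (rule c(1))
qed

lemma masks_run:
  assumes M: "pf_tm \<Sigma> M" and k: "Work k \<notin> tape_alphabet M"
    and "(tm_step M ^^ n) (q, p, t) = (q', p', t')" and "masks M k q p t s N"
  shows "\<exists>m\<le>n. \<exists>s' N'. (step_by (tidy_delta M k) ^^ m) (Simulate q, p, s) = (Simulate q', p', s') \<and>
           masks M k q' p' t' s' N' \<and> N' \<le> N + n"
  using assms(3-)
proof (induction n arbitrary: q p t s N)
  case 0
  then show ?case by auto
next
  case (Suc n)
  show ?case
  proof (cases "q \<in> accepting M")
    case True
    then have "tm_step M (q, p, t) = (q, p, t)"
      by (simp add: tm_step_def)
    then have "(tm_step M ^^ Suc n) (q, p, t) = (q, p, t)"
      by (induction n) auto
    then have "(step_by (tidy_delta M k) ^^ 0) (Simulate q, p, s) = (Simulate q', p', s)"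
      "masks M k q' p' t' s N"
      using Suc.prems by simp_all
    then show ?thesis by (intro exI[of _ 0]) auto
  next
    case False
    obtain q1 b d where d: "delta M q (t p) = (q1, b, d)" by (metis prod_cases3)
    then have 1: "tm_step M (q, p, t) = (q1, move_head d p, t(p := b))"
      using False by (simp add: tm_step_def)
    have "unmask k (s p) = t p" using Suc.prems by (simp add: masks_def)
    then have 2: "step_by (tidy_delta M k) (Simulate q, p, s)
        = (Simulate q1, move_head d p, s(p := mask k b))"
      using False d by (simp add: step_by_def)
    have "p \<le> N" using Suc.prems by (simp add: masks_def)
    have "(tm_step M ^^ n) (q1, move_head d p, t(p := b)) = (q', p', t')"
      using Suc.prems(1) 1 by (simp only: run_Suc)
    from Suc.IH[OF this masks_step[OF M k Suc.prems(2) d]]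
    obtain m s' N' where m: "m \<le> n"
      "(step_by (tidy_delta M k) ^^ m) (Simulate q1, move_head d p, s(p := mask k b))
         = (Simulate q', p', s')"
      "masks M k q' p' t' s' N'" "N' \<le> max N (Suc p) + n" by blast
    have "(step_by (tidy_delta M k) ^^ Suc m) (Simulate q, p, s) = (Simulate q', p', s')"
      using 2 m(2) by (simp only: run_Suc)
    moreover have "N' \<le> N + Suc n" using m(4) \<open>p \<le> N\<close> by simp
    ultimately show ?thesis using m by (intro exI[of _ "Suc m"]) auto
  qed
qed

lemma pf_machine_tidy:
  assumes M: "pf_tm \<Sigma> M"
  shows "pf_machine \<Sigma> (Simulate ` states M \<union> {Back, Forward, Clear, Home, Done})
           (insert (Work k) (tape_alphabet M)) (Simulate (start M)) Done (tidy_delta M k)"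
  unfolding pf_machine_def
proof (intro conjI ballI allI impI)
  fix q a q' b d
  assume q: "q \<in> Simulate ` states M \<union> {Back, Forward, Clear, Home, Done}"
    and a: "a \<in> insert (Work k) (tape_alphabet M)" and d: "tidy_delta M k q a = (q', b, d)"
  have bl: "Blank \<in> tape_alphabet M" by (rule pf_tm_basics[OF M])
  have "q' \<in> Simulate ` states M \<union> {Back, Forward, Clear, Home, Done} \<and>
      b \<in> insert (Work k) (tape_alphabet M) \<and>
      (b = Marker \<longleftrightarrow> a = Marker) \<and> (a = Marker \<longrightarrow> d \<noteq> MLeft)"
  proof (cases "\<exists>r. q = Simulate r \<and> r \<notin> accepting M")
    case True
    then obtain r where r: "q = Simulate r" "r \<notin> accepting M" "r \<in> states M" using q by auto
    obtain r' b' d' where d': "delta M r (unmask k a) = (r', b', d')" by (metis prod_cases3)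
    have "r' \<in> states M \<and> b' \<in> tape_alphabet M \<and> (b' = Marker \<longleftrightarrow> unmask k a = Marker) \<and>
        (unmask k a = Marker \<longrightarrow> d' \<noteq> MLeft)"
      by (rule pf_tm_delta[OF M r(3) unmask_in_alphabet[OF M a] d'])
    moreover have "unmask k a = Marker \<longleftrightarrow> a = Marker" by (auto simp: unmask_def)
    moreover have "mask k b' = Marker \<longleftrightarrow> b' = Marker" by (auto simp: mask_def)
    moreover have "q' = Simulate r'" "b = mask k b'" "d = d'" using d d' r by auto
    ultimately show ?thesis by (auto simp: mask_def)
  next
    case False
    then show ?thesis using q a d bl by (auto split: if_splits cell.splits)
  qed
  then show "q' \<in> Simulate ` states M \<union> {Back, Forward, Clear, Home, Done}"
    "b \<in> insert (Work k) (tape_alphabet M)" "b = Marker \<longleftrightarrow> a = Marker"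
    "a = Marker \<Longrightarrow> d \<noteq> MLeft" by blast+
qed (use pf_tm_basics[OF M] in auto)

text \<open>
  Each of the four sweeps is bounded by \<open>p\<close> or \<open>N\<close>; the output itself lies below \<open>N\<close> because none
  of its cells is a genuine blank.
\<close>

lemma tidy_up_run:
  assumes r: "masks M k q p t s N" and q: "q \<in> accepting M" and y: "has_output t y"
  shows "\<exists>m\<le>p + 2 * N + 5.
      (step_by (tidy_delta M k) ^^ m) (Simulate q, p, s) = (Done, 0, initial_tape y)"
proof -
  let ?\<delta> = "tidy_delta M k"
  let ?l = "Suc (length y)"
  have u: "unmask k (s i) = t i" and bl: "s i = Blank \<longleftrightarrow> N \<le> i" and ma: "s i = Marker \<longleftrightarrow> i = 0" for i
    using r by (auto simp: masks_def)
  have let_: "s i = Letter (y ! (i - 1))" if "0 < i" "i < ?l" for i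
  proof -
    have "t (Suc (i - 1)) = Letter (y ! (i - 1))" using y that unfolding has_output_def by (metis Suc_pred' Suc_less_eq)
    then show ?thesis using u[of i] that by (auto simp: unmask_def split: if_splits)
  qed
  \<comment> \<open>For empty \<open>y\<close> this is the cell of the marker.\<close>
  have "s (length y) \<noteq> Blank" using let_[of "length y"] ma[of 0] by (cases "length y") auto
  then have lN: "?l \<le> N" using bl[of "length y"] by simp
  have end_: "s ?l = Blank \<or> s ?l = Work k"
    using y u[of ?l] by (auto simp: has_output_def unmask_def split: if_splits)
  have s1: "(step_by ?\<delta> ^^ 1) (Simulate q, p, s) = (Back, p, s)"
    by (rule step_byI[where d = MStay and b = "s p"]) (use q in auto)
  have s2: "(step_by ?\<delta> ^^ p) (Back, p, s) = (Back, 0, s)"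
    by (rule rewind) (use ma in auto)
  have s3: "(step_by ?\<delta> ^^ 1) (Back, 0, s) = (Forward, 1, s)"
    by (rule step_byI[where d = MRight and b = Marker]) (use ma[of 0] in auto)
  have s4: "(step_by ?\<delta> ^^ (?l - 1)) (Forward, 1, s) = (Forward, ?l, s)"
    by (rule scan_right) (use let_ in auto)
  have s5: "(step_by ?\<delta> ^^ 1) (Forward, ?l, s) = (Clear, ?l, s)"
    by (rule step_byI[where d = MStay and b = "s ?l"]) (use end_ in auto)
  have s6: "(step_by ?\<delta> ^^ (N - ?l)) (Clear, ?l, s)
      = (Clear, N, \<lambda>i. if ?l \<le> i \<and> i < N then Blank else s i)"
    by (rule sweep_right) (use lN bl ma in auto)
  have clean: "(\<lambda>i. if ?l \<le> i \<and> i < N then Blank else s i) = initial_tape y"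
    using let_ ma bl by (auto simp: fun_eq_iff initial_tape_def)
  have s7: "(step_by ?\<delta> ^^ 1) (Clear, N, initial_tape y) = (Home, N, initial_tape y)"
    by (rule step_byI[where d = MStay and b = Blank]) (use lN in \<open>auto simp: initial_tape_def\<close>)
  have s8: "(step_by ?\<delta> ^^ N) (Home, N, initial_tape y) = (Home, 0, initial_tape y)"
    by (rule rewind) (auto simp: initial_tape_def)
  have s9: "(step_by ?\<delta> ^^ 1) (Home, 0, initial_tape y) = (Done, 0, initial_tape y)"
    by (rule step_byI[where d = MStay and b = Marker]) (auto simp: initial_tape_def)
  have "1 + (p + (1 + ((?l - 1) + (1 + ((N - ?l) + (1 + (N + 1))))))) \<le> p + 2 * N + 5"
    using lN by simp
  with run_trans[OF s1 run_trans[OF s2 run_trans[OF s3 run_trans[OF s4 run_trans[OF s5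
    run_trans[OF s6[unfolded clean] run_trans[OF s7 run_trans[OF s8 s9]]]]]]]]
  show "\<exists>m\<le>p + 2 * N + 5. (step_by ?\<delta> ^^ m) (Simulate q, p, s) = (Done, 0, initial_tape y)"
    by blast
qed

lemma tidily_computable_if_pf_linear_time:
  assumes "pf_linear_time_computable \<Sigma> f"
  shows "tidily_computable \<Sigma> f"
proof -
  obtain M c where f: "f ` lists \<Sigma> \<subseteq> lists \<Sigma>" and M: "pf_tm \<Sigma> M"
    and acc: "\<And>x. x \<in> lists \<Sigma> \<Longrightarrow> accepts_within M (c * (length x + 1)) x (f x)"
    using assms unfolding pf_linear_time_computable_def by blast
  have "finite (tape_alphabet M)" by (rule pf_tm_basics[OF M])
  then have "finite (Work -` tape_alphabet M)" by (rule finite_vimageI) (simp add: inj_def)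
  then obtain k where k: "Work k \<notin> tape_alphabet M"
    by (metis ex_new_if_finite infinite_UNIV_nat vimage_eq)
  obtain M' where M': "pf_tm \<Sigma> M'"
    and run: "\<And>n p t p' t'. range t \<subseteq> insert (Work k) (tape_alphabet M) \<Longrightarrow>
       (step_by (tidy_delta M k) ^^ n) (Simulate (start M), p, t) = (Done, p', t') \<Longrightarrow>
       \<exists>q\<in>accepting M'. (tm_step M' ^^ n) (start M', p, t) = (q, p', t')"
    using pf_machine_to_tm[OF pf_machine_tidy[OF M]] by blast
  have "\<exists>n\<le>(4 * c + 8) * (length x + 1). \<exists>q\<in>accepting M'.
      (tm_step M' ^^ n) (start M', 0, initial_tape x) = (q, 0, initial_tape (f x))"
    if x: "x \<in> lists \<Sigma>" for x
  proof -
    from acc[OF x] obtain n q p t where n: "n \<le> c * (length x + 1)"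
      and r: "(tm_step M ^^ n) (start M, 0, initial_tape x) = (q, p, t)"
      and q: "q \<in> accepting M" and out: "has_output t (f x)"
      unfolding accepts_within_def initial_config_def by blast
    have rg: "range (initial_tape x) \<subseteq> insert (Work k) (tape_alphabet M)"
      using range_initial_tape[OF x] pf_tm_basics[OF M] by blast
    have "initial_tape x i \<noteq> Work k" for i by (simp add: initial_tape_def)
    then have "masks M k (start M) 0 (initial_tape x) (initial_tape x) (Suc (length x))"
      using rg pf_tm_basics(6)[OF M] unfolding masks_def by (auto simp: unmask_def initial_tape_def)
    from masks_run[OF M k r this] obtain m s N where m: "m \<le> n"
      and r1: "(step_by (tidy_delta M k) ^^ m) (Simulate (start M), 0, initial_tape x) = (Simulate q, p, s)"
      and ms: "masks M k q p t s N" and N: "N \<le> Suc (length x) + n" by blast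
    have p: "p \<le> N" using ms by (simp add: masks_def)
    obtain m' where m': "m' \<le> p + 2 * N + 5" and
      r2: "(step_by (tidy_delta M k) ^^ m') (Simulate q, p, s) = (Done, 0, initial_tape (f x))"
      using tidy_up_run[OF ms q out] by blast
    from run[OF rg run_trans[OF r1 r2]] obtain q' where "q' \<in> accepting M'"
      "(tm_step M' ^^ (m + m')) (start M', 0, initial_tape x) = (q', 0, initial_tape (f x))"
      by blast
    moreover have "m + m' \<le> (4 * c + 8) * (length x + 1)"
      using m m' n p N by (simp add: algebra_simps)
    ultimately show ?thesis by blast
  qed
  then show ?thesis using f M' unfolding tidily_computable_def by blast
qed

lemma tm_run_locality:
  assumes "(tm_step M ^^ n) (q, p, t) = (q', p', t')"
  shows "p' \<le> p + n \<and> (\<forall>i\<ge>p + n. t' i = t i)"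
  using assms
proof (induction n arbitrary: q' p' t')
  case (Suc n)
  obtain q1 p1 t1 where 1: "(tm_step M ^^ n) (q, p, t) = (q1, p1, t1)" by (metis prod_cases3)
  then have s: "tm_step M (q1, p1, t1) = (q', p', t')" using Suc.prems by simp
  obtain q2 b d where d: "delta M q1 (t1 p1) = (q2, b, d)" by (metis prod_cases3)
  have "move_head d p1 \<le> Suc p1" by (cases d) auto
  then show ?case using Suc.IH[OF 1] s d by (auto simp: tm_step_def split: if_splits)
qed simp

text \<open>
  A machine produces at most one new letter per step. This bounds the input length, and hence the
  running time, of whatever is run on the output.
\<close>

lemma output_length_le:
  assumes "(tm_step M ^^ n) (q, 0, initial_tape x) = (q', p', initial_tape y)"
  shows "length y \<le> length x + n"
proof (rule ccontr)
  assume "\<not> ?thesis"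
  moreover from this have "initial_tape y (length y) = initial_tape x (length y)"
    using tm_run_locality[OF assms] by auto
  ultimately show False by (auto simp: initial_tape_def split: if_splits)
qed

datatype seq_state = First nat | Second nat | Stop

text \<open>
  The tests for the tape alphabets only keep the machine well-formed: a subroutine started on its own
  alphabet never meets a symbol outside it.
\<close>

fun seq_delta :: "'a tm \<Rightarrow> 'a tm \<Rightarrow> seq_state \<Rightarrow> 'a cell \<Rightarrow> seq_state \<times> 'a cell \<times> move" where
  "seq_delta M N (First q) a =
     (if q \<in> accepting M then (Second (start N), a, MStay)
      else if a \<in> tape_alphabet M then (let (q', b, d) = delta M q a in (First q', b, d))
      else (Stop, a, MStay))"
| "seq_delta M N (Second q) a =
     (if q \<in> accepting N then (Stop, a, MStay)
      else if a \<in> tape_alphabet N then (let (q', b, d) = delta N q a in (Second q', b, d))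
      else (Stop, a, MStay))"
| "seq_delta M N Stop a = (Stop, a, MStay)"

lemma pf_machine_seq:
  assumes M: "pf_tm \<Sigma> M" and N: "pf_tm \<Sigma> N"
  shows "pf_machine \<Sigma> (First ` states M \<union> Second ` states N \<union> {Stop})
           (tape_alphabet M \<union> tape_alphabet N) (First (start M)) Stop (seq_delta M N)"
  unfolding pf_machine_def
proof (intro conjI ballI allI impI)
  fix q a q' b d
  assume q: "q \<in> First ` states M \<union> Second ` states N \<union> {Stop}"
    and a: "a \<in> tape_alphabet M \<union> tape_alphabet N" and d: "seq_delta M N q a = (q', b, d)"
  have st: "start N \<in> states N" by (rule pf_tm_basics[OF N])
  have "q' \<in> First ` states M \<union> Second ` states N \<union> {Stop} \<and> b \<in> tape_alphabet M \<union> tape_alphabet N \<and>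
      (b = Marker \<longleftrightarrow> a = Marker) \<and> (a = Marker \<longrightarrow> d \<noteq> MLeft)"
  proof (cases q)
    case (First r)
    show ?thesis
    proof (cases "r \<notin> accepting M \<and> a \<in> tape_alphabet M")
      case True
      then obtain r' where r': "delta M r a = (r', b, d)" "q' = First r'"
        using d First by (auto split: prod.splits)
      then show ?thesis using pf_tm_delta[OF M _ _ r'(1)] q First True by auto
    next
      case False
      then show ?thesis using d First a st by (auto split: if_splits)
    qed
  next
    case (Second r)
    show ?thesis
    proof (cases "r \<notin> accepting N \<and> a \<in> tape_alphabet N")
      case True
      then obtain r' where r': "delta N r a = (r', b, d)" "q' = Second r'"
        using d Second by (auto split: prod.splits)
      then show ?thesis using pf_tm_delta[OF N _ _ r'(1)] q Second True by auto
    next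
      case False
      then show ?thesis using d Second a by (auto split: if_splits)
    qed
  next
    case Stop
    then show ?thesis using d a by simp
  qed
  then show "q' \<in> First ` states M \<union> Second ` states N \<union> {Stop}"
    "b \<in> tape_alphabet M \<union> tape_alphabet N" "b = Marker \<longleftrightarrow> a = Marker"
    "a = Marker \<Longrightarrow> d \<noteq> MLeft" by blast+
qed (use pf_tm_basics[OF M] pf_tm_basics[OF N] in auto)

text \<open>
  The output of the first machine has linear length, so the second one, run on it, also takes time
  linear in the original input length.
\<close>

lemma tidily_computable_compose:
  assumes "tidily_computable \<Sigma> f" "tidily_computable \<Sigma> g"
  shows "tidily_computable \<Sigma> (\<lambda>x. g (f x))"
proof -
  from assms(1) obtain M c where f: "f ` lists \<Sigma> \<subseteq> lists \<Sigma>" and M: "pf_tm \<Sigma> M"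
    and M_run: "\<forall>x\<in>lists \<Sigma>. \<exists>n\<le>c * (length x + 1). \<exists>q\<in>accepting M.
        (tm_step M ^^ n) (start M, 0, initial_tape x) = (q, 0, initial_tape (f x))"
    unfolding tidily_computable_def by (elim conjE exE)
  from assms(2) obtain N c' where g: "g ` lists \<Sigma> \<subseteq> lists \<Sigma>" and N: "pf_tm \<Sigma> N"
    and N_run: "\<forall>x\<in>lists \<Sigma>. \<exists>n\<le>c' * (length x + 1). \<exists>q\<in>accepting N.
        (tm_step N ^^ n) (start N, 0, initial_tape x) = (q, 0, initial_tape (g x))"
    unfolding tidily_computable_def by (elim conjE exE)
  let ?\<delta> = "seq_delta M N"
  obtain K where K: "pf_tm \<Sigma> K"
    and run: "\<And>n p t p' t'. range t \<subseteq> tape_alphabet M \<union> tape_alphabet N \<Longrightarrow>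
       (step_by ?\<delta> ^^ n) (First (start M), p, t) = (Stop, p', t') \<Longrightarrow>
       \<exists>q\<in>accepting K. (tm_step K ^^ n) (start K, p, t) = (q, p', t')"
    using pf_machine_to_tm[OF pf_machine_seq[OF M N]] by blast
  have alph: "range (initial_tape x) \<subseteq> tape_alphabet M" "range (initial_tape x) \<subseteq> tape_alphabet N"
    if "x \<in> lists \<Sigma>" for x
    using range_initial_tape[OF that] pf_tm_basics[OF M] pf_tm_basics[OF N] by auto
  have st: "start M \<in> states M" "start N \<in> states N" by (rule pf_tm_basics[OF M], rule pf_tm_basics[OF N])
  have "\<exists>n\<le>(c + c' * (c + 1) + 2) * (length x + 1). \<exists>q\<in>accepting K.
      (tm_step K ^^ n) (start K, 0, initial_tape x) = (q, 0, initial_tape (g (f x)))"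
    if x: "x \<in> lists \<Sigma>" for x
  proof -
    have fx: "f x \<in> lists \<Sigma>" using f x by blast
    from bspec[OF M_run x] obtain n q where n: "n \<le> c * (length x + 1)" and q: "q \<in> accepting M"
      and r: "(tm_step M ^^ n) (start M, 0, initial_tape x) = (q, 0, initial_tape (f x))" by blast
    from bspec[OF N_run fx] obtain n' q' where n': "n' \<le> c' * (length (f x) + 1)" and q': "q' \<in> accepting N"
      and r': "(tm_step N ^^ n') (start N, 0, initial_tape (f x)) = (q', 0, initial_tape (g (f x)))"
      by blast
    have "\<exists>m\<le>n. (step_by ?\<delta> ^^ m) (First (start M), 0, initial_tape x) = (First q, 0, initial_tape (f x))"
      by (rule tm_run_embeds[where e = First, OF M _ r st(1) alph(1)[OF x]]) simp
    then obtain m where m: "m \<le> n" and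
      s1: "(step_by ?\<delta> ^^ m) (First (start M), 0, initial_tape x) = (First q, 0, initial_tape (f x))"
      by blast
    have s2: "(step_by ?\<delta> ^^ 1) (First q, 0, initial_tape (f x)) = (Second (start N), 0, initial_tape (f x))"
      by (rule step_byI[where d = MStay and b = "initial_tape (f x) 0"]) (use q in auto)
    have "\<exists>m\<le>n'. (step_by ?\<delta> ^^ m) (Second (start N), 0, initial_tape (f x))
        = (Second q', 0, initial_tape (g (f x)))"
      by (rule tm_run_embeds[where e = Second, OF N _ r' st(2) alph(2)[OF fx]]) simp
    then obtain m' where m': "m' \<le> n'" and
      s3: "(step_by ?\<delta> ^^ m') (Second (start N), 0, initial_tape (f x))
        = (Second q', 0, initial_tape (g (f x)))"
      by blast
    have s4: "(step_by ?\<delta> ^^ 1) (Second q', 0, initial_tape (g (f x))) = (Stop, 0, initial_tape (g (f x)))"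
      by (rule step_byI[where d = MStay and b = "initial_tape (g (f x)) 0"]) (use q' in auto)
    have "range (initial_tape x) \<subseteq> tape_alphabet M \<union> tape_alphabet N"
      using alph(1)[OF x] by (rule le_supI1)
    from run[OF this run_trans[OF s1 run_trans[OF s2 run_trans[OF s3 s4]]]]
    have out: "\<exists>p\<in>accepting K. (tm_step K ^^ (m + (1 + (m' + 1)))) (start K, 0, initial_tape x)
        = (p, 0, initial_tape (g (f x)))" .
    have "length (f x) + 1 \<le> (c + 1) * (length x + 1)"
      using output_length_le[OF r] n by simp
    from order_trans[OF n' mult_le_mono2[OF this]]
    have "n' \<le> c' * (c + 1) * (length x + 1)" by (simp only: mult.assoc)
    with m n m' have "m + m' + 2 \<le> c * (length x + 1) + c' * (c + 1) * (length x + 1) + 2 * (length x + 1)"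
      by (intro add_mono) (auto intro: order_trans)
    then have "m + (1 + (m' + 1)) \<le> (c + c' * (c + 1) + 2) * (length x + 1)"
      by (simp only: add_mult_distrib)
    with out show ?thesis by (intro exI conjI)
  qed
  moreover have "(\<lambda>x. g (f x)) ` lists \<Sigma> \<subseteq> lists \<Sigma>"
    using f g by (simp add: image_subset_iff)
  ultimately show ?thesis
    unfolding tidily_computable_def using K by (intro conjI exI[of _ K] exI[of _ "c + c' * (c + 1) + 2"]) auto
qed

section \<open>Working below the last letter\<close>

text \<open>
  That a letter is the last one shows only in the next cell. It is erased after that inspection
  (\<open>Check\<close>), so a malformed input is never changed. From then on the letter survives only as the
  parameter of the state.
\<close>

datatype 'a last_state =
  Scan | Check 'a | Erase 'a | Rewind 'a | Run 'a nat | Append 'a | Halt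

fun last_delta ::
  "'a set \<Rightarrow> ('a \<Rightarrow> 'a tm) \<Rightarrow> ('a \<Rightarrow> 'a) \<Rightarrow> 'a last_state \<Rightarrow> 'a cell \<Rightarrow> 'a last_state \<times> 'a cell \<times> move" where
  "last_delta B M \<kappa> Scan a =
     (case a of Marker \<Rightarrow> (Scan, a, MRight)
      | Letter x \<Rightarrow> ((if x \<in> B then Check x else Scan), a, MRight)
      | _ \<Rightarrow> (Halt, a, MStay))"
| "last_delta B M \<kappa> (Check b) a = (if a = Blank then (Erase b, a, MLeft) else (Halt, a, MStay))"
| "last_delta B M \<kappa> (Erase b) a = (if a = Marker then (Halt, a, MStay) else (Rewind b, Blank, MLeft))"
| "last_delta B M \<kappa> (Rewind b) a =
     (if a = Marker then (Run b (start (M b)), a, MStay) else (Rewind b, a, MLeft))"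
| "last_delta B M \<kappa> (Run b q) a =
     (if q \<in> accepting (M b) then (Append b, a, MStay)
      else if a \<in> tape_alphabet (M b) then (let (q', c, d) = delta (M b) q a in (Run b q', c, d))
      else (Halt, a, MStay))"
| "last_delta B M \<kappa> (Append b) a =
     (case a of Marker \<Rightarrow> (Append b, a, MRight) | Letter x \<Rightarrow> (Append b, a, MRight)
      | _ \<Rightarrow> (Halt, Letter (\<kappa> b), MStay))"
| "last_delta B M \<kappa> Halt a = (Halt, a, MStay)"

definition last_states :: "'a set \<Rightarrow> ('a \<Rightarrow> 'a tm) \<Rightarrow> 'a last_state set" where
  "last_states B M =
     {Scan, Halt} \<union> Check ` B \<union> Erase ` B \<union> Rewind ` B \<union> Append ` B \<union> (\<Union>b\<in>B. Run b ` states (M b))"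

definition last_alphabet :: "'a set \<Rightarrow> 'a set \<Rightarrow> ('a \<Rightarrow> 'a tm) \<Rightarrow> 'a cell set" where
  "last_alphabet \<Sigma> B M = {Marker, Blank} \<union> Letter ` (\<Sigma> \<union> B) \<union> (\<Union>b\<in>B. tape_alphabet (M b))"

lemma pf_machine_last:
  assumes "finite \<Sigma>" "finite B" and M: "\<And>b. b \<in> B \<Longrightarrow> pf_tm \<Sigma> (M b)" and \<kappa>: "\<kappa> ` B \<subseteq> B"
  shows "pf_machine (\<Sigma> \<union> B) (last_states B M) (last_alphabet \<Sigma> B M) Scan Halt (last_delta B M \<kappa>)"
  unfolding pf_machine_def
proof (intro conjI ballI allI impI)
  fix q a q' b d
  assume q: "q \<in> last_states B M" and a: "a \<in> last_alphabet \<Sigma> B M"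
    and d: "last_delta B M \<kappa> q a = (q', b, d)"
  have "q' \<in> last_states B M \<and> b \<in> last_alphabet \<Sigma> B M \<and>
      (b = Marker \<longleftrightarrow> a = Marker) \<and> (a = Marker \<longrightarrow> d \<noteq> MLeft)"
  proof (cases "\<exists>c r. q = Run c r \<and> r \<notin> accepting (M c) \<and> a \<in> tape_alphabet (M c)")
    case True
    then obtain c r where r: "q = Run c r" "r \<notin> accepting (M c)" "a \<in> tape_alphabet (M c)" by blast
    then have c: "c \<in> B" "r \<in> states (M c)" using q by (auto simp: last_states_def)
    obtain r' where r': "delta (M c) r a = (r', b, d)" "q' = Run c r'"
      using d r by (auto split: prod.splits)
    have "r' \<in> states (M c) \<and> b \<in> tape_alphabet (M c) \<and> (b = Marker \<longleftrightarrow> a = Marker) \<and>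
        (a = Marker \<longrightarrow> d \<noteq> MLeft)"
      by (rule pf_tm_delta[OF M[OF c(1)] c(2) r(3) r'(1)])
    then show ?thesis using c r' by (auto simp: last_states_def last_alphabet_def)
  next
    case False
    have st: "start (M b) \<in> states (M b)" if "b \<in> B" for b by (rule pf_tm_basics[OF M[OF that]])
    have al: "Blank \<in> last_alphabet \<Sigma> B M" "\<And>b. b \<in> B \<Longrightarrow> Letter (\<kappa> b) \<in> last_alphabet \<Sigma> B M"
      using \<kappa> by (auto simp: last_alphabet_def)
    have stt: "Scan \<in> last_states B M" "Halt \<in> last_states B M"
      "\<And>b. b \<in> B \<Longrightarrow> Check b \<in> last_states B M" "\<And>b. b \<in> B \<Longrightarrow> Erase b \<in> last_states B M"
      "\<And>b. b \<in> B \<Longrightarrow> Rewind b \<in> last_states B M" "\<And>b. b \<in> B \<Longrightarrow> Append b \<in> last_states B M"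
      "\<And>b. b \<in> B \<Longrightarrow> Run b (start (M b)) \<in> last_states B M"
      using st unfolding last_states_def by blast+
    have inB: "c \<in> B" if "q = Check c \<or> q = Erase c \<or> q = Rewind c \<or> q = Append c \<or> (\<exists>r. q = Run c r)" for c
      using that q by (auto simp: last_states_def)
    show ?thesis
      using False a d inB al stt by (cases q) (auto split: if_splits cell.splits)
  qed
  then show "q' \<in> last_states B M" "b \<in> last_alphabet \<Sigma> B M" "b = Marker \<longleftrightarrow> a = Marker"
    "a = Marker \<Longrightarrow> d \<noteq> MLeft" by blast+
qed (use assms(1,2) pf_tm_basics[OF M] in \<open>auto simp: last_states_def last_alphabet_def\<close>)

lemma has_output_initial_tape: "has_output (initial_tape x) x"
  by (auto simp: has_output_def initial_tape_def)

lemma initial_tape_letter: "i < length x \<Longrightarrow> initial_tape x (Suc i) = Letter (x ! i)"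
  by (simp add: initial_tape_def)

lemma initial_tape_append_letter: "(initial_tape x)(Suc (length x) := Letter b) = initial_tape (x @ [b])"
  by (auto simp: initial_tape_def fun_eq_iff nth_append le_Suc_eq)

lemma last_scan:
  assumes "u \<in> lists \<Sigma>" "\<Sigma> \<inter> B = {}"
  shows "(step_by (last_delta B M \<kappa>) ^^ Suc (length u)) (Scan, 0, initial_tape (u @ v))
     = (Scan, Suc (length u), initial_tape (u @ v))"
proof -
  have "last_delta B M \<kappa> Scan (initial_tape (u @ v) i) = (Scan, initial_tape (u @ v) i, MRight)"
    if "i < Suc (length u)" for i
  proof (cases i)
    case 0
    then show ?thesis by (simp add: initial_tape_def)
  next
    case (Suc j)
    then have "u ! j \<in> \<Sigma>" using that assms(1) by (auto simp: in_lists_conv_set)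
    then have "u ! j \<notin> B" using assms(2) by blast
    then show ?thesis using that Suc by (simp add: initial_tape_letter nth_append)
  qed
  then show ?thesis
    using scan_right[of 0 "Suc (length u)" "last_delta B M \<kappa>" Scan "initial_tape (u @ v)"] by simp
qed

lemma last_run:
  assumes u: "u \<in> lists \<Sigma>" and b: "b \<in> B" and disj: "\<Sigma> \<inter> B = {}" and M: "pf_tm \<Sigma> (M b)"
    and r: "(tm_step (M b) ^^ n) (start (M b), 0, initial_tape u) = (q, 0, initial_tape y)"
    and q: "q \<in> accepting (M b)"
  shows "\<exists>m\<le>2 * n + 3 * length u + 8. (step_by (last_delta B M \<kappa>) ^^ m) (Scan, 0, initial_tape (u @ [b]))
     = (Halt, Suc (length y), initial_tape (y @ [\<kappa> b]))"
proof -
  let ?\<delta> = "last_delta B M \<kappa>"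
  let ?l = "Suc (length u)"
  let ?t = "initial_tape (u @ [b])"
  have s1: "(step_by ?\<delta> ^^ ?l) (Scan, 0, ?t) = (Scan, ?l, ?t)"
    by (rule last_scan[OF u disj])
  have s2: "(step_by ?\<delta> ^^ 1) (Scan, ?l, ?t) = (Check b, Suc ?l, ?t)"
    by (rule step_byI[where d = MRight and b = "Letter b"])
       (use b in \<open>auto simp: initial_tape_def nth_append\<close>)
  have s3: "(step_by ?\<delta> ^^ 1) (Check b, Suc ?l, ?t) = (Erase b, ?l, ?t)"
    by (rule step_byI[where d = MLeft and b = Blank]) (auto simp: initial_tape_def)
  have s4: "(step_by ?\<delta> ^^ 1) (Erase b, ?l, ?t) = (Rewind b, length u, initial_tape u)"
    by (rule step_byI[where d = MLeft and b = Blank])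
       (auto simp: initial_tape_def fun_eq_iff nth_append)
  have s5: "(step_by ?\<delta> ^^ length u) (Rewind b, length u, initial_tape u) = (Rewind b, 0, initial_tape u)"
    by (rule rewind) (auto simp: initial_tape_def)
  have s6: "(step_by ?\<delta> ^^ 1) (Rewind b, 0, initial_tape u) = (Run b (start (M b)), 0, initial_tape u)"
    by (rule step_byI[where d = MStay and b = Marker]) (auto simp: initial_tape_def)
  have "range (initial_tape u) \<subseteq> tape_alphabet (M b)" "start (M b) \<in> states (M b)"
    using range_initial_tape[OF u] pf_tm_basics[OF M] by auto
  then have "\<exists>m\<le>n. (step_by ?\<delta> ^^ m) (Run b (start (M b)), 0, initial_tape u) = (Run b q, 0, initial_tape y)"
    by (intro tm_run_embeds[where e = "Run b", OF M _ r]) simp_all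
  then obtain m where m: "m \<le> n"
    and s7: "(step_by ?\<delta> ^^ m) (Run b (start (M b)), 0, initial_tape u) = (Run b q, 0, initial_tape y)"
    by blast
  have s8: "(step_by ?\<delta> ^^ 1) (Run b q, 0, initial_tape y) = (Append b, 0, initial_tape y)"
    by (rule step_byI[where d = MStay and b = "initial_tape y 0"]) (use q in auto)
  have s9: "(step_by ?\<delta> ^^ (Suc (length y) - 0)) (Append b, 0, initial_tape y)
      = (Append b, Suc (length y), initial_tape y)"
    by (rule scan_right) (auto simp: initial_tape_def)
  have s10: "(step_by ?\<delta> ^^ 1) (Append b, Suc (length y), initial_tape y)
      = (Halt, Suc (length y), initial_tape (y @ [\<kappa> b]))"
    by (rule step_byI[where d = MStay and b = "Letter (\<kappa> b)"])
       (simp_all add: initial_tape_append_letter, simp add: initial_tape_def)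
  have "length y \<le> length u + n" by (rule output_length_le[OF r])
  then have "?l + (1 + (1 + (1 + (length u + (1 + (m + (1 + ((Suc (length y) - 0) + 1))))))))
      \<le> 2 * n + 3 * length u + 8"
    using m by simp
  with run_trans[OF s1 run_trans[OF s2 run_trans[OF s3 run_trans[OF s4 run_trans[OF s5
    run_trans[OF s6 run_trans[OF s7 run_trans[OF s8 run_trans[OF s9 s10]]]]]]]]]
  show ?thesis by blast
qed

text \<open>
  The function computed has to be total on words over \<open>\<Sigma> \<union> B\<close>. On a word that is not a word over
  \<open>\<Sigma>\<close> followed by one letter from \<open>B\<close>, the scan runs into a blank or into a letter from \<open>B\<close> with
  something behind it before any cell has been changed.
\<close>

lemma last_ignores_malformed:
  assumes x: "x \<in> lists (\<Sigma> \<union> B)" and disj: "\<Sigma> \<inter> B = {}"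
    and mal: "\<not> (x \<noteq> [] \<and> last x \<in> B \<and> butlast x \<in> lists \<Sigma>)"
  shows "\<exists>m\<le>length x + 2. \<exists>p. (step_by (last_delta B M \<kappa>) ^^ m) (Scan, 0, initial_tape x)
     = (Halt, p, initial_tape x)"
proof (cases "x \<in> lists \<Sigma>")
  case True
  have "(step_by (last_delta B M \<kappa>) ^^ Suc (length x)) (Scan, 0, initial_tape x)
     = (Scan, Suc (length x), initial_tape x)"
    using last_scan[OF True disj, where v = "[]"] by simp
  moreover have "(step_by (last_delta B M \<kappa>) ^^ 1) (Scan, Suc (length x), initial_tape x)
     = (Halt, Suc (length x), initial_tape x)"
    by (rule step_byI[where d = MStay and b = Blank]) (auto simp: initial_tape_def)
  ultimately have "(step_by (last_delta B M \<kappa>) ^^ (Suc (length x) + 1)) (Scan, 0, initial_tape x)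
     = (Halt, Suc (length x), initial_tape x)" by (rule run_trans)
  then show ?thesis by (intro exI[of _ "Suc (length x) + 1"]) auto
next
  case False
  then have "\<exists>b\<in>set x. b \<notin> \<Sigma>" by (auto simp: in_lists_conv_set)
  then obtain u b v where xs: "x = u @ b # v" "b \<notin> \<Sigma>" "\<forall>z\<in>set u. z \<in> \<Sigma>"
    using split_list_first_prop[of x "\<lambda>z. z \<notin> \<Sigma>"] by blast
  then have u: "u \<in> lists \<Sigma>" and b: "b \<in> B" using x by (auto simp: in_lists_conv_set)
  have "v \<noteq> []" using mal u b xs(1) by auto
  then obtain z v' where v: "v = z # v'" by (cases v) auto
  have "(step_by (last_delta B M \<kappa>) ^^ Suc (length u)) (Scan, 0, initial_tape x)
     = (Scan, Suc (length u), initial_tape x)"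
    using last_scan[OF u disj] xs(1) by simp
  moreover have "(step_by (last_delta B M \<kappa>) ^^ 1) (Scan, Suc (length u), initial_tape x)
     = (Check b, Suc (Suc (length u)), initial_tape x)"
    by (rule step_byI[where d = MRight and b = "Letter b"])
       (use b xs(1) in \<open>auto simp: initial_tape_def nth_append\<close>)
  moreover have "initial_tape x (Suc (Suc (length u))) = Letter z"
    using xs(1) v by (simp add: initial_tape_def nth_append)
  then have "(step_by (last_delta B M \<kappa>) ^^ 1) (Check b, Suc (Suc (length u)), initial_tape x)
     = (Halt, Suc (Suc (length u)), initial_tape x)"
    by (intro step_byI[where d = MStay and b = "Letter z"]) auto
  ultimately have "(step_by (last_delta B M \<kappa>) ^^ (Suc (length u) + (1 + 1))) (Scan, 0, initial_tape x)
     = (Halt, Suc (Suc (length u)), initial_tape x)" by (blast intro: run_trans)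
  moreover have "Suc (length u) + (1 + 1) \<le> length x + 2" using xs(1) by simp
  ultimately show ?thesis by blast
qed

text \<open>
  Since \<open>B\<close> is finite, the machines for all \<open>g b\<close> fit into one machine, with the sum of their time
  constants as a common constant.
\<close>

lemma pf_linear_time_computable_last_letter:
  assumes fin: "finite \<Sigma>" "finite B" and disj: "\<Sigma> \<inter> B = {}"
    and g: "\<And>b. b \<in> B \<Longrightarrow> tidily_computable \<Sigma> (g b)" and \<kappa>: "\<kappa> ` B \<subseteq> B"
  shows "pf_linear_time_computable (\<Sigma> \<union> B)
     (\<lambda>x. if x \<noteq> [] \<and> last x \<in> B \<and> butlast x \<in> lists \<Sigma>
          then g (last x) (butlast x) @ [\<kappa> (last x)] else x)"
    (is "pf_linear_time_computable _ ?f")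
proof -
  have "\<forall>b\<in>B. \<exists>M c. pf_tm \<Sigma> M \<and> (\<forall>x\<in>lists \<Sigma>. \<exists>n\<le>c * (length x + 1). \<exists>q\<in>accepting M.
        (tm_step M ^^ n) (start M, 0, initial_tape x) = (q, 0, initial_tape (g b x)))"
    using g unfolding tidily_computable_def by blast
  then obtain M c where M: "\<And>b. b \<in> B \<Longrightarrow> pf_tm \<Sigma> (M b)"
    and Mrun: "\<And>b x. b \<in> B \<Longrightarrow> x \<in> lists \<Sigma> \<Longrightarrow> \<exists>n\<le>c b * (length x + 1). \<exists>q\<in>accepting (M b).
        (tm_step (M b) ^^ n) (start (M b), 0, initial_tape x) = (q, 0, initial_tape (g b x))"
    by metis
  let ?\<delta> = "last_delta B M \<kappa>"
  obtain K where K: "pf_tm (\<Sigma> \<union> B) K"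
    and run: "\<And>n p t p' t'. range t \<subseteq> last_alphabet \<Sigma> B M \<Longrightarrow>
       (step_by ?\<delta> ^^ n) (Scan, p, t) = (Halt, p', t') \<Longrightarrow>
       \<exists>q\<in>accepting K. (tm_step K ^^ n) (start K, p, t) = (q, p', t')"
    using pf_machine_to_tm[OF pf_machine_last[where M = M and \<kappa> = \<kappa>, OF fin M \<kappa>]] by blast
  define C where "C = (\<Sum>b\<in>B. c b)"
  have C: "c b \<le> C" if "b \<in> B" for b
    using member_le_sum[OF that, of c] fin(2) by (simp add: C_def)
  have "accepts_within K ((2 * C + 8) * (length x + 1)) x (?f x)" if x: "x \<in> lists (\<Sigma> \<union> B)" for x
  proof -
    have "\<exists>m\<le>(2 * C + 8) * (length x + 1). \<exists>p.
        (step_by ?\<delta> ^^ m) (Scan, 0, initial_tape x) = (Halt, p, initial_tape (?f x))"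
    proof (cases "x \<noteq> [] \<and> last x \<in> B \<and> butlast x \<in> lists \<Sigma>")
      case True
      define u b where "u = butlast x" and "b = last x"
      have ub: "u \<in> lists \<Sigma>" "b \<in> B" "x = u @ [b]" using True by (auto simp: u_def b_def)
      obtain n q where n: "n \<le> c b * (length u + 1)" and q: "q \<in> accepting (M b)"
        and r: "(tm_step (M b) ^^ n) (start (M b), 0, initial_tape u) = (q, 0, initial_tape (g b u))"
        using Mrun[OF ub(2,1)] by blast
      obtain m where m: "m \<le> 2 * n + 3 * length u + 8"
        "(step_by ?\<delta> ^^ m) (Scan, 0, initial_tape x)
           = (Halt, Suc (length (g b u)), initial_tape (g b u @ [\<kappa> b]))"
        using last_run[where M = M and \<kappa> = \<kappa>, OF ub(1,2) disj M[OF ub(2)] r q] ub(3) by blast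
      have "c b * (length u + 1) \<le> C * (length x + 1)"
        using C[OF ub(2)] ub(3) by (intro mult_le_mono) auto
      then have "m \<le> (2 * C + 8) * (length x + 1)"
        using m(1) n ub(3) by (simp add: algebra_simps)
      moreover have fx: "?f x = g b u @ [\<kappa> b]" using True by (simp add: u_def b_def)
      ultimately show ?thesis unfolding fx using m(2) by blast
    next
      case False
      then have fx: "?f x = x" by (rule if_not_P)
      have "length x + 2 \<le> (2 * C + 8) * (length x + 1)" by (simp add: algebra_simps)
      then show ?thesis
        unfolding fx using last_ignores_malformed[OF x disj False, of M \<kappa>] by (blast intro: order_trans)
    qed
    then obtain m p where m: "m \<le> (2 * C + 8) * (length x + 1)" and
      r: "(step_by ?\<delta> ^^ m) (Scan, 0, initial_tape x) = (Halt, p, initial_tape (?f x))"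
      by (elim exE conjE)
    have "range (initial_tape x) \<subseteq> last_alphabet \<Sigma> B M"
      by (rule range_initial_tape[OF x]) (auto simp: last_alphabet_def)
    from run[OF this r] m show ?thesis
      unfolding accepts_within_def initial_config_def using has_output_initial_tape by blast
  qed
  moreover have "?f ` lists (\<Sigma> \<union> B) \<subseteq> lists (\<Sigma> \<union> B)"
  proof -
    have "?f x \<in> lists (\<Sigma> \<union> B)" if x: "x \<in> lists (\<Sigma> \<union> B)" for x
    proof (cases "x \<noteq> [] \<and> last x \<in> B \<and> butlast x \<in> lists \<Sigma>")
      case True
      then have "g (last x) (butlast x) \<in> lists \<Sigma>"
        using g unfolding tidily_computable_def by blast
      moreover have "\<kappa> (last x) \<in> B" using True \<kappa> by blast
      ultimately show ?thesis using True by auto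
    qed (use x in \<open>simp only: if_not_P not_False_eq_True\<close>)
    then show ?thesis by blast
  qed
  ultimately show ?thesis using K unfolding pf_linear_time_computable_def by blast
qed

section \<open>Coset representatives\<close>

text \<open>
  The second component is determined because distinct cosets are disjoint, the first by cancellation.
\<close>

lemma (in group) bij_betw_transversal:
  assumes H: "subgroup H G" and \<rho>: "bij_betw \<rho> B (rcosets H)"
    and a: "\<And>b. b \<in> B \<Longrightarrow> a b \<in> \<rho> b"
  shows "bij_betw (\<lambda>(h, b). h \<otimes> a b) (H \<times> B) (carrier G)"
proof -
  have cos: "\<rho> b \<in> rcosets H" if "b \<in> B" for b
    using \<rho> that by (auto simp: bij_betw_def)
  have ac: "a b \<in> carrier G" if "b \<in> B" for b
    using a[OF that] cos[OF that] subgroup.rcosets_carrier[OF H is_group] by blast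
  have eq: "\<rho> b = H #> a b" if b: "b \<in> B" for b
  proof -
    obtain g where g: "g \<in> carrier G" "\<rho> b = H #> g"
      using cos[OF b] by (auto simp: RCOSETS_def)
    then show ?thesis using repr_independence[of "a b" H g] a[OF b] H by simp
  qed
  have Hc: "H \<subseteq> carrier G" using H by (rule subgroup.subset)
  have in_coset: "h \<otimes> a b \<in> \<rho> b" if "h \<in> H" "b \<in> B" for h b
    using that eq by (auto simp: r_coset_def)
  show ?thesis
    unfolding bij_betw_def
  proof (intro conjI inj_onI Set.set_eqI iffI)
    fix v w assume v: "v \<in> H \<times> B" and w: "w \<in> H \<times> B"
      and e: "(case v of (h, b) \<Rightarrow> h \<otimes> a b) = (case w of (h, b) \<Rightarrow> h \<otimes> a b)"
    obtain h b h' b' where vw: "v = (h, b)" "w = (h', b')" by fastforce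
    then have m: "h \<in> H" "b \<in> B" "h' \<in> H" "b' \<in> B" and e': "h \<otimes> a b = h' \<otimes> a b'" using v w e by auto
    have "\<rho> b = \<rho> b'"
      using rcos_disjoint[OF H] cos[OF m(2)] cos[OF m(4)] in_coset[OF m(1,2)] in_coset[OF m(3,4)] e'
      by (auto simp: pairwise_def disjnt_def)
    then have "b = b'" using \<rho> m by (auto simp: bij_betw_def dest: inj_onD)
    moreover have "h = h'" using e' right_cancel[OF ac[OF m(2)]] m Hc \<open>b = b'\<close> by blast
    ultimately show "v = w" using vw by simp
  next
    fix g assume "g \<in> (\<lambda>(h, b). h \<otimes> a b) ` (H \<times> B)"
    then show "g \<in> carrier G" using ac Hc by auto
  next
    fix g assume g: "g \<in> carrier G"
    have "H #> g \<in> rcosets H" using g by (auto simp: RCOSETS_def)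
    then obtain b where b: "b \<in> B" "\<rho> b = H #> g" using bij_betw_imp_surj_on[OF \<rho>] by (metis imageE)
    have "g \<in> H #> g" using rcos_self[OF g H] .
    then have "g \<in> H #> a b" using eq[OF b(1)] b(2) by simp
    then show "g \<in> (\<lambda>(h, b). h \<otimes> a b) ` (H \<times> B)" using b by (auto simp: r_coset_def)
  qed
qed

text \<open>
  The representatives are indexed by elements of a given infinite set because the indices serve as
  letters that have to avoid a given alphabet.
\<close>

lemma (in group) finite_transversal:
  assumes H: "subgroup H G" and "finite (rcosets H)" and "infinite (A :: 'c set)"
  obtains B :: "'c set" and a where "finite B" "B \<subseteq> A" "a ` B \<subseteq> carrier G"
    "bij_betw (\<lambda>(h, b). h \<otimes> a b) (H \<times> B) (carrier G)"
proof -
  obtain B where B: "finite B" "card B = card (rcosets H)" "B \<subseteq> A"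
    using infinite_arbitrarily_large[OF assms(3)] by blast
  then obtain \<rho> where \<rho>: "bij_betw \<rho> B (rcosets H)"
    using finite_same_card_bij assms(2) by blast
  have "\<exists>g. g \<in> \<rho> b" if "b \<in> B" for b
  proof -
    have "\<rho> b \<in> rcosets H" using \<rho> that by (auto simp: bij_betw_def)
    then show ?thesis using rcos_self[OF _ H] by (auto simp: RCOSETS_def)
  qed
  then obtain a where a: "\<And>b. b \<in> B \<Longrightarrow> a b \<in> \<rho> b" by metis
  have "a ` B \<subseteq> carrier G"
    using a \<rho> subgroup.rcosets_carrier[OF H is_group] by (auto simp: bij_betw_def)
  then show ?thesis
    using that B bij_betw_transversal[OF H \<rho> a] by blast
qed

lemma semigroup_span_mono: "S \<subseteq> T \<Longrightarrow> g \<in> semigroup_span G S \<Longrightarrow> g \<in> semigroup_span G T"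
  by (rotate_tac, induction rule: semigroup_span.induct) (auto intro: semigroup_span.intros)

lemma semigroup_span_subgroup: "semigroup_span (G\<lparr>carrier := H\<rparr>) S = semigroup_span G S"
proof (intro Set.set_eqI iffI)
  show "g \<in> semigroup_span G S" if "g \<in> semigroup_span (G\<lparr>carrier := H\<rparr>) S" for g
    using that by induction (auto intro: semigroup_span.intros)
  show "g \<in> semigroup_span (G\<lparr>carrier := H\<rparr>) S" if "g \<in> semigroup_span G S" for g
    using that
  proof induction
    case (mult g s)
    then show ?case using semigroup_span.mult[of g "G\<lparr>carrier := H\<rparr>" S s] by simp
  qed (rule semigroup_span.incl)
qed

text \<open>
  Appending a generator to the product \<open>h\<close> appends one more computation. Tidy
  computability is what makes the composition possible.
\<close>

lemma (in group) right_translation_tidily_computable: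
  assumes S: "S \<subseteq> carrier G" and \<psi>: "\<psi> ` L \<subseteq> carrier G"
    and f: "\<forall>s\<in>S. pf_linear_time_computable \<Sigma> (f s) \<and>
      (\<forall>w\<in>L. f s w \<in> L \<and> \<psi> (f s w) = \<psi> w \<otimes> s)"
    and h: "h \<in> semigroup_span G S"
  shows "h \<in> carrier G \<and> (\<exists>g. tidily_computable \<Sigma> g \<and> (\<forall>w\<in>L. g w \<in> L \<and> \<psi> (g w) = \<psi> w \<otimes> h))"
  using h
proof induction
  case (incl s)
  then show ?case using S f tidily_computable_if_pf_linear_time by blast
next
  case (mult h s)
  then obtain g where g: "tidily_computable \<Sigma> g" "\<And>w. w \<in> L \<Longrightarrow> g w \<in> L \<and> \<psi> (g w) = \<psi> w \<otimes> h"
    by blast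
  have hs: "h \<in> carrier G" "s \<in> carrier G" using mult S by auto
  have "tidily_computable \<Sigma> (\<lambda>x. f s (g x))"
    using tidily_computable_compose g(1) tidily_computable_if_pf_linear_time f mult.hyps(2) by blast
  moreover have "f s (g w) \<in> L \<and> \<psi> (f s (g w)) = \<psi> w \<otimes> (h \<otimes> s)" if "w \<in> L" for w
    using that g(2)[OF that] bspec[OF f mult.hyps(2)] hs \<psi> m_assoc by auto
  ultimately show ?case using hs by blast
qed

lemma bij_betw_append_last:
  assumes \<psi>: "bij_betw \<psi> L H" and F: "bij_betw (\<lambda>(h, b). m h (a b)) (H \<times> B) K"
  shows "bij_betw (\<lambda>x. m (\<psi> (butlast x)) (a (last x))) {u @ v | u v. u \<in> L \<and> v \<in> (\<lambda>b. [b]) ` B} K"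
proof -
  have "bij_betw (\<lambda>x. (butlast x, last x)) {u @ v | u v. u \<in> L \<and> v \<in> (\<lambda>b. [b]) ` B} (L \<times> B)"
    by (rule bij_betw_byWitness[where f' = "\<lambda>(u, b). u @ [b]"]) auto
  moreover have "bij_betw (\<lambda>(u, b). (\<psi> u, b)) (L \<times> B) (H \<times> B)"
    using \<psi> unfolding bij_betw_def inj_on_def by fastforce
  ultimately show ?thesis
    using bij_betw_trans[OF bij_betw_trans F] by (fastforce simp: comp_def intro: bij_betw_cong[THEN iffD1, rotated])
qed

theorem theorem4:
  fixes C :: "'a::infinite lang_class" and G :: "('g, 'm) monoid_scheme" (structure)
  assumes "language_class C"
    and "closed_under_symbol_change C"
    and "closed_under_disjoint_finite_concat C"
    and "group G"
    and "subgroup H G"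
    and "finite (rcosets H)"
    and "cayley_pf_linear_time C (G\<lparr>carrier := H\<rparr>)"
  shows "cayley_pf_linear_time C G"
proof -
  interpret group G by fact
  note H = \<open>subgroup H G\<close>
  have Hc: "H \<subseteq> carrier G" using H by (rule subgroup.subset)
  from assms(7) obtain S \<Sigma> L \<psi> f where finS: "finite S" and SH: "S \<subseteq> H" and gen: "H \<subseteq> semigroup_span G S"
    and \<Sigma>L: "(\<Sigma>, L) \<in> C" and \<psi>: "bij_betw \<psi> L H"
    and f: "\<forall>s\<in>S. pf_linear_time_computable \<Sigma> (f s) \<and>
      (\<forall>w\<in>L. f s w \<in> L \<and> \<psi> (f s w) = \<psi> w \<otimes> s)"
    unfolding cayley_pf_linear_time_def finite_semigroup_generators_def cayley_pf_linear_time_wrt_def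
    by (auto simp: semigroup_span_subgroup)
  have S_carrier: "S \<subseteq> carrier G" and \<psi>_carrier: "\<psi> ` L \<subseteq> carrier G"
    using SH Hc bij_betw_imp_surj_on[OF \<psi>] by auto
  have \<Sigma>: "finite \<Sigma>" "L \<subseteq> lists \<Sigma>"
    using assms(1) \<Sigma>L unfolding language_class_def by blast+
  have "infinite (- \<Sigma>)"
    using \<Sigma>(1) infinite_UNIV by (simp add: finite_compl)
  from finite_transversal[OF H assms(6) this]
  obtain B a where finB: "finite B" and BA: "B \<subseteq> - \<Sigma>" and a: "a ` B \<subseteq> carrier G"
    and trans: "bij_betw (\<lambda>(h, b). h \<otimes> a b) (H \<times> B) (carrier G)"
    by metis
  from BA have disj: "\<Sigma> \<inter> B = {}" by blast
  define L' where "L' = {u @ v | u v. u \<in> L \<and> v \<in> (\<lambda>b. [b]) ` B}"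
  define \<psi>' where "\<psi>' = (\<lambda>x. \<psi> (butlast x) \<otimes> a (last x))"
  have "(\<Sigma> \<union> B, L') \<in> C"
    unfolding L'_def
    by (rule assms(3)[unfolded closed_under_disjoint_finite_concat_def, rule_format])
       (use \<Sigma>L finB disj in auto)
  moreover have "bij_betw \<psi>' L' (carrier G)"
    unfolding \<psi>'_def L'_def by (rule bij_betw_append_last[where m = "(\<otimes>)", OF \<psi> trans])
  moreover have "\<exists>f'. pf_linear_time_computable (\<Sigma> \<union> B) f' \<and>
      (\<forall>x\<in>L'. f' x \<in> L' \<and> \<psi>' (f' x) = \<psi>' x \<otimes> s)" if s: "s \<in> carrier G" for s
  proof -
    have "\<exists>g c. tidily_computable \<Sigma> g \<and> c \<in> B \<and>
        (\<forall>w\<in>L. g w \<in> L \<and> \<psi> (g w) \<otimes> a c = \<psi> w \<otimes> a b \<otimes> s)" if b: "b \<in> B" for b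
    proof -
      have abc: "a b \<in> carrier G" using a b by blast
      then have "a b \<otimes> s \<in> (\<lambda>(h, b). h \<otimes> a b) ` (H \<times> B)"
        using trans s unfolding bij_betw_def by auto
      then obtain h c where hc: "h \<in> H" "c \<in> B" "a b \<otimes> s = h \<otimes> a c" by auto
      have "h \<in> semigroup_span G S" using gen hc(1) by blast
      from right_translation_tidily_computable[where f = f, OF S_carrier \<psi>_carrier f this]
      obtain g where g: "tidily_computable \<Sigma> g"
        and g_transl: "\<forall>w\<in>L. g w \<in> L \<and> \<psi> (g w) = \<psi> w \<otimes> h"
        by (elim exE conjE)
      have "\<psi> (g w) \<otimes> a c = \<psi> w \<otimes> a b \<otimes> s" if "w \<in> L" for w
      proof -
        have "\<psi> w \<in> carrier G" using \<psi> that Hc by (auto simp: bij_betw_def)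
        moreover have "a c \<in> carrier G" "h \<in> carrier G" using a hc Hc by auto
        ultimately show ?thesis using g_transl that hc(3) abc s by (simp add: m_assoc)
      qed
      then show ?thesis using g g_transl hc(2) by blast
    qed
    then obtain g \<kappa> where g: "\<And>b. b \<in> B \<Longrightarrow> tidily_computable \<Sigma> (g b)" and \<kappa>: "\<And>b. b \<in> B \<Longrightarrow> \<kappa> b \<in> B"
      and gL: "\<And>b w. b \<in> B \<Longrightarrow> w \<in> L \<Longrightarrow> g b w \<in> L \<and> \<psi> (g b w) \<otimes> a (\<kappa> b) = \<psi> w \<otimes> a b \<otimes> s"
      by metis
    let ?f = "\<lambda>x. if x \<noteq> [] \<and> last x \<in> B \<and> butlast x \<in> lists \<Sigma>
          then g (last x) (butlast x) @ [\<kappa> (last x)] else x"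
    have "pf_linear_time_computable (\<Sigma> \<union> B) ?f"
      by (rule pf_linear_time_computable_last_letter[OF \<Sigma>(1) finB disj g]) (use \<kappa> in auto)
    moreover have "?f x \<in> L' \<and> \<psi>' (?f x) = \<psi>' x \<otimes> s" if x': "x \<in> L'" for x
    proof -
      obtain w b where x: "x = w @ [b]" "w \<in> L" "b \<in> B" using x' by (auto simp: L'_def)
      then have "?f x = g b w @ [\<kappa> b]" using \<Sigma>(2) by auto
      then show ?thesis using gL[OF x(3,2)] \<kappa>[OF x(3)] x by (auto simp: L'_def \<psi>'_def)
    qed
    ultimately show ?thesis by blast
  qed
  then obtain F where "\<And>s. s \<in> carrier G \<Longrightarrow> pf_linear_time_computable (\<Sigma> \<union> B) (F s) \<and>
      (\<forall>x\<in>L'. F s x \<in> L' \<and> \<psi>' (F s x) = \<psi>' x \<otimes> s)" by metis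
  moreover have S'c: "S \<union> a ` B \<subseteq> carrier G" using SH Hc a by blast
  ultimately have "cayley_pf_linear_time_wrt C G (S \<union> a ` B)"
    unfolding cayley_pf_linear_time_wrt_def by blast
  moreover have "finite_semigroup_generators G (S \<union> a ` B)"
    unfolding finite_semigroup_generators_def
  proof (intro conjI subsetI)
    fix g assume "g \<in> carrier G"
    then have "g \<in> (\<lambda>(h, b). h \<otimes> a b) ` (H \<times> B)"
      using bij_betw_imp_surj_on[OF trans] by simp
    then obtain h b where hb: "h \<in> H" "b \<in> B" "g = h \<otimes> a b"
      by auto
    then have "h \<in> semigroup_span G (S \<union> a ` B)"
      using gen semigroup_span_mono[of S "S \<union> a ` B"] by blast
    then show "g \<in> semigroup_span G (S \<union> a ` B)"
      using hb by (auto intro: semigroup_span.mult)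
  qed (use finS finB S'c in auto)
  ultimately show ?thesis unfolding cayley_pf_linear_time_def by blast
qed

end
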